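(* Let $F=f+\psi$ be as in the context, satisfying the smoothness assumption with vector $L$ and the local quadratic error bound assumption. Let $x_0\in\operatorname{dom}(F)$, let $K\ge1$ be an integer, and let $\{x_{tK}\}_{t\ge0}$ be the sequence generated by the fixed-restart scheme FixedRES$(x_0,K)$. Then for all $t\ge 0$ $$\operatorname{dist}_L(x_{tK},\mathcal X_\star)^2\le\left(\min\left(\frac{\theta_{K-1}^2}{\mu_F(L,x_0)},\ \frac{1}{1+\frac{\mu_F(L,x_0)}{2\theta_{K-1}^2}}\right)\right)^{t}\operatorname{dist}_L(x_0,\mathcal X_\star)^2 .$$
   Context: Setting: $f:\mathbb R^n\to\mathbb R$ is convex and differentiable, $\psi:\mathbb R^n\to\mathbb R\cup\{+\infty\}$ is proper, closed and convex, $F:=f+\psi$, $F^\star:=\min_{\mathbb R^n}F$, and the set $\mathcal X_\star$ of minimizers of $F$ is nonempty. For a vector $v$ with positive entries, $\|x\|_v^2:=\sum_{i=1}^n v_i(x^i)^2$, and $\operatorname{dist}_v(x,\mathcal X_\star)$ is the distance from $x$ to $\mathcal X_\star$ in the norm $\|\cdot\|_v$. Smoothness assumption: there is $L\in\mathbb R^n$ with positive entries such that $f(x)\le f(y)+\langle\nabla f(y),x-y\rangle+\frac12\|x-y\|_L^2$ for all $x,y\in\mathbb R^n$. Local quadratic error bound assumption: for every $x_0\in\operatorname{dom}(F)$ there is a constant $\mu_F(L,x_0)>0$ such that $F(x)\ge F^\star+\frac{\mu_F(L,x_0)}{2}\operatorname{dist}_L(x,\mathcal X_\star)^2$ for all $x$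 with $F(x)\le F(x_0)$. Sequence $(\theta_k)$: $\theta_0=1$, $\theta_{k+1}=\frac{\sqrt{\theta_k^4+4\theta_k^2}-\theta_k^2}{2}$. FISTA$(x_0,K)$: set $z_0=x_0$; for $k=0,\dots,K-1$ set $y_k=(1-\theta_k)x_k+\theta_kz_k$, $x_{k+1}=\arg\min_{x}\{\langle\nabla f(y_k),x-y_k\rangle+\frac12\|x-y_k\|_L^2+\psi(x)\}$, $z_{k+1}=z_k+\frac1{\theta_k}(x_{k+1}-y_k)$. The output is $x_K$. APG$(x_0,K)$: set $z_0=x_0$; for $k=0,\dots,K-1$ set $y_k=(1-\theta_k)x_k+\theta_kz_k$, $z_{k+1}=\arg\min_{z}\{\langle\nabla f(y_k),z-y_k\rangle+\frac{\theta_k}2\|z-z_k\|_L^2+\psi(z)\}$, $x_{k+1}=y_k+\theta_k(z_{k+1}-z_k)$. The output is $x_K$. FixedRES$(x_0,K)$: for $t=0,1,\dots$, $x_{(t+1)K}$ is the output of APG$(x_{tK},K)$ or of FISTA$(x_{tK},K)$. *)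

theory Defs
  imports "HOL-Analysis.Analysis"
begin

definition grad :: "(real^'n \<Rightarrow> real) \<Rightarrow> real^'n \<Rightarrow> real^'n" where
  "grad f x = (THE D. GDERIV f x :> D)"

text \<open>The gradient is well defined wherever the function is differentiable.\<close>

lemma GDERIV_grad:
  fixes f :: "real^'n \<Rightarrow> real"
  assumes "f differentiable (at x)"
  shows "GDERIV f x :> grad f x"
proof -
  obtain f' where f': "(f has_derivative f') (at x)"
    using assms by (auto simp: differentiable_def)
  then have "linear f'"
    by (rule has_derivative_linear)
  then have "f' h = h \<bullet> adjoint f' 1" for h
    using adjoint_works[of f' h 1] by simp
  then have "f' = (\<lambda>h. h \<bullet> adjoint f' 1)" by blast
  with f' have D: "GDERIV f x :> adjoint f' 1"
    unfolding gderiv_def by simp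
  show ?thesis
    unfolding grad_def
  proof (rule theI[where P="\<lambda>D. GDERIV f x :> D", OF D])
    fix D' assume "GDERIV f x :> D'"
    with D have "(\<lambda>h. h \<bullet> D') = (\<lambda>h. h \<bullet> adjoint f' 1)"
      unfolding gderiv_def by (rule has_derivative_unique[rotated])
    then show "D' = adjoint f' 1"
      by (metis vector_eq_ldot)
  qed
qed

text \<open>Functions with values in \<open>\<real> \<union> {\<infinity>}\<close> are \<open>ereal\<close>-valued functions that never
  take the value \<open>-\<infinity>\<close>; the latter is part of properness. Closedness and convexity are those
  of the epigraph.\<close>

definition edom :: "(real^'n \<Rightarrow> ereal) \<Rightarrow> (real^'n) set" where
  "edom g = {x. g x < \<infinity>}"

definition epi :: "(real^'n \<Rightarrow> ereal) \<Rightarrow> ((real^'n) \<times> real) set" where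
  "epi g = {(x, r). g x \<le> ereal r}"

definition proper_fun :: "(real^'n \<Rightarrow> ereal) \<Rightarrow> bool" where
  "proper_fun g \<longleftrightarrow> (\<forall>x. g x \<noteq> -\<infinity>) \<and> edom g \<noteq> {}"

definition closed_fun :: "(real^'n \<Rightarrow> ereal) \<Rightarrow> bool" where
  "closed_fun g \<longleftrightarrow> closed (epi g)"

definition convex_fun :: "(real^'n \<Rightarrow> ereal) \<Rightarrow> bool" where
  "convex_fun g \<longleftrightarrow> convex (epi g)"

definition wnorm :: "real^'n \<Rightarrow> real^'n \<Rightarrow> real" where
  "wnorm v x = sqrt (\<Sum>i\<in>UNIV. v $ i * (x $ i)\<^sup>2)"

definition wdist :: "real^'n \<Rightarrow> real^'n \<Rightarrow> (real^'n) set \<Rightarrow> real" where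
  "wdist v x S = (INF y\<in>S. wnorm v (x - y))"

definition objective :: "(real^'n \<Rightarrow> real) \<Rightarrow> (real^'n \<Rightarrow> ereal) \<Rightarrow> real^'n \<Rightarrow> ereal" where
  "objective f \<psi> x = ereal (f x) + \<psi> x"

definition minimizers :: "(real^'n \<Rightarrow> ereal) \<Rightarrow> (real^'n) set" where
  "minimizers g = {x. is_arg_min g (\<lambda>_. True) x}"

text \<open>The minimum of \<open>g\<close>, provided it is attained, that is, \<open>minimizers g \<noteq> {}\<close>.\<close>

definition min_value :: "(real^'n \<Rightarrow> ereal) \<Rightarrow> ereal" where
  "min_value g = (INF x. g x)"

definition smooth_wrt :: "(real^'n \<Rightarrow> real) \<Rightarrow> real^'n \<Rightarrow> bool" where
  "smooth_wrt f L \<longleftrightarrow> (\<forall>i. L $ i > 0) \<and>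
     (\<forall>x y. f x \<le> f y + grad f y \<bullet> (x - y) + 1/2 * (wnorm L (x - y))\<^sup>2)"

text \<open>Here \<open>\<mu> L x0\<close> is the error bound constant attached to the starting point \<open>x0\<close>.\<close>

definition local_error_bound ::
  "(real^'n \<Rightarrow> ereal) \<Rightarrow> real^'n \<Rightarrow> (real^'n \<Rightarrow> real^'n \<Rightarrow> real) \<Rightarrow> bool" where
  "local_error_bound F L \<mu> \<longleftrightarrow> (\<forall>x0\<in>edom F. \<mu> L x0 > 0 \<and>
     (\<forall>x. F x \<le> F x0 \<longrightarrow>
        F x \<ge> min_value F + ereal (\<mu> L x0 / 2 * (wdist L x (minimizers F))\<^sup>2)))"

fun \<theta> :: "nat \<Rightarrow> real" where
  "\<theta> 0 = 1"
| "\<theta> (Suc k) = (sqrt (\<theta> k ^ 4 + 4 * (\<theta> k)\<^sup>2) - (\<theta> k)\<^sup>2) / 2"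

text \<open>\<open>fista_output f \<psi> L x0 K w\<close> says that \<open>w\<close> is the output of \<open>K\<close> iterations started at
  \<open>x0\<close>, and likewise for \<open>apg_output\<close>. The subproblems are strongly convex, so for proper, closed
  and convex \<open>\<psi>\<close> they have exactly one minimizer and the output is unique.\<close>

definition fista_output ::
  "(real^'n \<Rightarrow> real) \<Rightarrow> (real^'n \<Rightarrow> ereal) \<Rightarrow> real^'n \<Rightarrow> real^'n \<Rightarrow> nat \<Rightarrow> real^'n \<Rightarrow> bool" where
  "fista_output f \<psi> L x0 K w \<longleftrightarrow> (\<exists>x y z :: nat \<Rightarrow> real^'n.
     x 0 = x0 \<and> z 0 = x0 \<and>
     (\<forall>k<K.
        y k = (1 - \<theta> k) *\<^sub>R x k + \<theta> k *\<^sub>R z k \<and>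
        is_arg_min
          (\<lambda>u. ereal (grad f (y k) \<bullet> (u - y k) + 1/2 * (wnorm L (u - y k))\<^sup>2) + \<psi> u)
          (\<lambda>_. True) (x (Suc k)) \<and>
        z (Suc k) = z k + (1 / \<theta> k) *\<^sub>R (x (Suc k) - y k)) \<and>
     w = x K)"

definition apg_output ::
  "(real^'n \<Rightarrow> real) \<Rightarrow> (real^'n \<Rightarrow> ereal) \<Rightarrow> real^'n \<Rightarrow> real^'n \<Rightarrow> nat \<Rightarrow> real^'n \<Rightarrow> bool" where
  "apg_output f \<psi> L x0 K w \<longleftrightarrow> (\<exists>x y z :: nat \<Rightarrow> real^'n.
     x 0 = x0 \<and> z 0 = x0 \<and>
     (\<forall>k<K.
        y k = (1 - \<theta> k) *\<^sub>R x k + \<theta> k *\<^sub>R z k \<and>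
        is_arg_min
          (\<lambda>u. ereal (grad f (y k) \<bullet> (u - y k) + \<theta> k / 2 * (wnorm L (u - z k))\<^sup>2) + \<psi> u)
          (\<lambda>_. True) (z (Suc k)) \<and>
        x (Suc k) = y k + \<theta> k *\<^sub>R (z (Suc k) - z k)) \<and>
     w = x K)"

text \<open>Only the entries of \<open>x\<close> at multiples of \<open>K\<close> matter. The inner method may be chosen
  anew at every restart.\<close>

definition fixed_res ::
  "(real^'n \<Rightarrow> real) \<Rightarrow> (real^'n \<Rightarrow> ereal) \<Rightarrow> real^'n \<Rightarrow> real^'n \<Rightarrow> nat \<Rightarrow> (nat \<Rightarrow> real^'n) \<Rightarrow> bool" where
  "fixed_res f \<psi> L x0 K x \<longleftrightarrow> x 0 = x0 \<and>
     (\<forall>t. apg_output f \<psi> L (x (t * K)) K (x ((t + 1) * K)) \<or>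
          fista_output f \<psi> L (x (t * K)) K (x ((t + 1) * K)))"

end

theory Submission
  imports Defs
begin

text \<open>APG and FISTA both satisfy, for every \<open>u\<close> in the domain,
  \<open>F x\<^sub>k\<^sub>+\<^sub>1 \<le> (1 - \<theta>\<^sub>k) F x\<^sub>k + \<theta>\<^sub>k F u + \<theta>\<^sub>k\<^sup>2/2 (\<parallel>z\<^sub>k - u\<parallel>\<^sup>2 - \<parallel>z\<^sub>k\<^sub>+\<^sub>1 - u\<parallel>\<^sup>2)\<close> and
  \<open>x\<^sub>k\<^sub>+\<^sub>1 = (1 - \<theta>\<^sub>k) x\<^sub>k + \<theta>\<^sub>k z\<^sub>k\<^sub>+\<^sub>1\<close>. Telescoping with \<open>u = x\<^sub>0\<close> shows that the level of \<open>x\<^sub>0\<close>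
  is never left, so that the error bound applies along the whole run; telescoping with a minimizer
  \<open>u\<close> then gives \<open>\<mu>/\<theta>\<^sub>k\<^sup>2 dist(x\<^sub>k\<^sub>+\<^sub>1)\<^sup>2 + dist(z\<^sub>k\<^sub>+\<^sub>1)\<^sup>2 \<le> dist(x\<^sub>0)\<^sup>2\<close>. The first rate is immediate.
  For the second, convexity of the squared distance to the convex set of minimizers yields
  \<open>dist(x\<^sub>k\<^sub>+\<^sub>1)\<^sup>2 \<le> (1 - \<theta>\<^sub>k) dist(x\<^sub>k)\<^sup>2 + \<theta>\<^sub>k dist(z\<^sub>k\<^sub>+\<^sub>1)\<^sup>2\<close>, and
  \<open>(1 + \<mu>/(2 \<theta>\<^sub>k\<^sup>2)) dist(x\<^sub>k\<^sub>+\<^sub>1)\<^sup>2 \<le> dist(x\<^sub>0)\<^sup>2\<close> follows by induction on \<open>k\<close>.\<close>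

section \<open>The step-size sequence\<close>

text \<open>With \<open>a = (\<theta> k)\<^sup>2\<close>, the next value is the positive root of
  \<open>t\<^sup>2 = (1 - t) * a\<close>; positivity of the left side forces
  \<open>t < 1\<close>.\<close>

lemma theta_Suc_bounds:
  assumes "\<theta> k > 0"
  shows "0 < \<theta> (Suc k)" "\<theta> (Suc k) < 1" "(\<theta> (Suc k))\<^sup>2 = (1 - \<theta> (Suc k)) * (\<theta> k)\<^sup>2"
proof -
  define a where "a = (\<theta> k)\<^sup>2"
  define t where "t = \<theta> (Suc k)"
  have a: "a > 0"
    using assms by (simp add: a_def)
  have t: "t = (sqrt (a\<^sup>2 + 4 * a) - a) / 2"
    by (simp add: t_def a_def flip: power_mult)
  have "(2 * t + a)\<^sup>2 = a\<^sup>2 + 4 * a"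
    using a by (simp add: t diff_divide_distrib)
  then have eq: "t\<^sup>2 = (1 - t) * a"
    by (simp add: power2_eq_square algebra_simps)
  have "sqrt (a\<^sup>2) < sqrt (a\<^sup>2 + 4 * a)"
    using a by (intro real_sqrt_less_mono) auto
  then have t0: "t > 0"
    using a by (simp add: t)
  have "0 < (1 - t) * a"
    using t0 by (simp flip: eq)
  then have t1: "t < 1"
    using a by (simp add: zero_less_mult_iff)
  show "0 < \<theta> (Suc k)" "\<theta> (Suc k) < 1" "(\<theta> (Suc k))\<^sup>2 = (1 - \<theta> (Suc k)) * (\<theta> k)\<^sup>2"
    using t0 t1 eq by (simp_all only: t_def a_def)
qed

declare \<theta>.simps(2) [simp del]

lemma theta_pos: "0 < \<theta> k"
  by (induction k) (simp, rule theta_Suc_bounds)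

lemma theta_le_1: "\<theta> k \<le> 1"
  using theta_Suc_bounds(2)[OF theta_pos] by (cases k) (simp, metis less_imp_le)

lemma theta_Suc_sq: "(\<theta> (Suc k))\<^sup>2 = (1 - \<theta> (Suc k)) * (\<theta> k)\<^sup>2"
  by (rule theta_Suc_bounds(3)[OF theta_pos])

section \<open>Weighted norm and distance to a set\<close>

context
  fixes L :: "real^'n"
  assumes L_pos: "\<And>i. L $ i > 0"
begin

lemma wnorm_nonneg: "wnorm L x \<ge> 0"
  unfolding wnorm_def by (intro real_sqrt_ge_zero sum_nonneg mult_nonneg_nonneg)
    (auto intro: less_imp_le[OF L_pos])

lemma wnorm_sq: "(wnorm L x)\<^sup>2 = (\<Sum>i\<in>UNIV. L $ i * (x $ i)\<^sup>2)"
  unfolding wnorm_def by (intro real_sqrt_pow2 sum_nonneg mult_nonneg_nonneg)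
    (auto intro: less_imp_le[OF L_pos])

lemma wnorm_sq_scaleR: "(wnorm L (c *\<^sub>R x))\<^sup>2 = c\<^sup>2 * (wnorm L x)\<^sup>2"
  by (simp add: wnorm_sq sum_distrib_left power_mult_distrib algebra_simps)

text \<open>The exact defect term supplies the strong convexity behind
  \<open>prox_three_point\<close>; dropping it gives the convexity used in
  \<open>wdist_sq_convex\<close>.\<close>

lemma wnorm_sq_convex_combination:
  "(wnorm L ((1 - s) *\<^sub>R a + s *\<^sub>R b))\<^sup>2 =
     (1 - s) * (wnorm L a)\<^sup>2 + s * (wnorm L b)\<^sup>2 - s * (1 - s) * (wnorm L (a - b))\<^sup>2"
  by (simp add: wnorm_sq sum_distrib_left flip: sum.distrib sum_subtractf)
    (rule sum.cong, simp, simp add: power2_eq_square algebra_simps)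

lemma wdist_nonneg: "S \<noteq> {} \<Longrightarrow> wdist L x S \<ge> 0"
  unfolding wdist_def by (rule cINF_greatest) (auto simp: wnorm_nonneg)

lemma wdist_sq_le:
  assumes "u \<in> S"
  shows "(wdist L x S)\<^sup>2 \<le> (wnorm L (x - u))\<^sup>2"
proof (rule power_mono)
  show "wdist L x S \<le> wnorm L (x - u)"
    unfolding wdist_def by (rule cINF_lower[OF bdd_belowI2 assms]) (rule wnorm_nonneg)
  show "0 \<le> wdist L x S"
    using assms by (intro wdist_nonneg) auto
qed

text \<open>Lower bounds on the squared distance are obtained through all points of
  \<open>S\<close>, so no nearest point has to exist.\<close>

lemma wdist_sq_greatest:
  assumes "S \<noteq> {}" "\<And>u. u \<in> S \<Longrightarrow> c \<le> (wnorm L (x - u))\<^sup>2"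
  shows "c \<le> (wdist L x S)\<^sup>2"
proof (cases "c \<le> 0")
  case False
  have "sqrt c \<le> wdist L x S"
    unfolding wdist_def using assms(1)
  proof (rule cINF_greatest)
    fix u assume "u \<in> S"
    then show "sqrt c \<le> wnorm L (x - u)"
      using assms(2) by (simp add: real_le_lsqrt wnorm_nonneg)
  qed
  then have "(sqrt c)\<^sup>2 \<le> (wdist L x S)\<^sup>2"
    using False by (intro power_mono) auto
  with False show ?thesis by simp
qed (use zero_le_power2[of "wdist L x S"] in linarith)

lemma wdist_sq_convex:
  assumes S: "convex S" "S \<noteq> {}" and s: "0 < s" "s < 1"
  shows "(wdist L ((1 - s) *\<^sub>R x + s *\<^sub>R z) S)\<^sup>2
    \<le> (1 - s) * (wdist L x S)\<^sup>2 + s * (wdist L z S)\<^sup>2"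
proof -
  define c where "c = (wdist L ((1 - s) *\<^sub>R x + s *\<^sub>R z) S)\<^sup>2"
  have *: "c \<le> (1 - s) * (wnorm L (x - u))\<^sup>2 + s * (wnorm L (z - v))\<^sup>2"
    if "u \<in> S" "v \<in> S" for u v
  proof -
    have "(1 - s) *\<^sub>R u + s *\<^sub>R v \<in> S"
      using S s that by (intro convexD) auto
    then have "c \<le> (wnorm L ((1 - s) *\<^sub>R x + s *\<^sub>R z - ((1 - s) *\<^sub>R u + s *\<^sub>R v)))\<^sup>2"
      unfolding c_def by (rule wdist_sq_le)
    also have "(1 - s) *\<^sub>R x + s *\<^sub>R z - ((1 - s) *\<^sub>R u + s *\<^sub>R v)
        = (1 - s) *\<^sub>R (x - u) + s *\<^sub>R (z - v)"
      by (simp add: algebra_simps)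
    finally show ?thesis
      using s by (simp add: wnorm_sq_convex_combination)
        (smt (verit) mult_nonneg_nonneg zero_le_power2)
  qed
  \<comment> \<open>The infimum is taken over \<open>v\<close> first, with \<open>u\<close> fixed,
    and then over \<open>u\<close>.\<close>
  have **: "c \<le> (1 - s) * (wnorm L (x - u))\<^sup>2 + s * (wdist L z S)\<^sup>2" if "u \<in> S" for u
  proof -
    have "(c - (1 - s) * (wnorm L (x - u))\<^sup>2) / s \<le> (wdist L z S)\<^sup>2"
      using *[OF that] s by (intro wdist_sq_greatest[OF S(2)]) (simp add: field_simps)
    then show ?thesis using s by (simp add: field_simps)
  qed
  have "(c - s * (wdist L z S)\<^sup>2) / (1 - s) \<le> (wdist L x S)\<^sup>2"
    using ** s by (intro wdist_sq_greatest[OF S(2)]) (simp add: field_simps)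
  then show ?thesis
    using s by (simp add: field_simps c_def)
qed

end

text \<open>One iteration of the distance estimate: \<open>d\<close> and \<open>e\<close> stand for the squared distances of
  \<open>x\<^sub>k\<^sub>+\<^sub>1\<close> and \<open>x\<^sub>k\<close>, \<open>c\<close> for that of the starting point, \<open>q = \<theta>\<^sub>k\<close> and
  \<open>b = \<mu> / (2 \<theta>\<^sub>k\<^sup>2)\<close>. As \<open>(1 - \<theta>\<^sub>k) / \<theta>\<^sub>k\<^sup>2 = 1 / \<theta>\<^sub>k\<^sub>-\<^sub>1\<^sup>2\<close>, the previous value of \<open>b\<close>
  is \<open>(1 - q) * b\<close>.\<close>

lemma contraction_step:
  fixes b d e p q c :: real
  assumes q: "0 < q" "q < 1" and b: "0 \<le> b" and c: "0 \<le> c"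
    and e: "(1 + (1 - q) * b) * e \<le> c"
    and d: "d \<le> (1 - q) * e + q * (c - 2 * b * d)"
  shows "(1 + b) * d \<le> c"
proof -
  let ?p = "1 - q"
  have pb: "0 \<le> ?p * b" using q b by simp
  have "(1 + 2 * q * b) * d \<le> ?p * e + q * c"
    using d by (simp add: algebra_simps)
  then have "(1 + ?p * b) * ((1 + 2 * q * b) * d) \<le> (1 + ?p * b) * (?p * e + q * c)"
    using pb by (intro mult_left_mono) auto
  also have "\<dots> = ?p * ((1 + ?p * b) * e) + (1 + ?p * b) * q * c"
    by (simp add: algebra_simps)
  also have "\<dots> \<le> ?p * c + (1 + ?p * b) * q * c"
    using e q by (intro add_right_mono mult_left_mono) auto
  finally have 1: "(1 + ?p * b) * (1 + 2 * q * b) * d \<le> (1 + q * ?p * b) * c"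
    by (simp add: algebra_simps)
  \<comment> \<open>The surplus is nonnegative, so the factor \<open>1 + q * ?p * b\<close> can be
    split off on the left of \<open>1\<close> and cancelled.\<close>
  have "(1 + ?p * b) * (1 + 2 * q * b) - (1 + q * ?p * b) * (1 + b) = q * q * b + q * ?p * b * b"
    by (simp add: algebra_simps)
  moreover have "0 \<le> q * q * b + q * ?p * b * b"
    using q b by (intro add_nonneg_nonneg mult_nonneg_nonneg) auto
  ultimately have 2: "(1 + q * ?p * b) * (1 + b) \<le> (1 + ?p * b) * (1 + 2 * q * b)"
    by linarith
  have pos: "0 < 1 + q * ?p * b"
    using q b by (intro add_pos_nonneg mult_nonneg_nonneg) auto
  show ?thesis
  \<comment> \<open>A negative \<open>d\<close> would reverse inequality \<open>2\<close> under
    multiplication, but then the claim is trivial.\<close>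
  proof (cases "d \<le> 0")
    case True
    then have "(1 + b) * d \<le> 0" using b by (simp add: mult_nonneg_nonpos)
    with c show ?thesis by simp
  next
    case False
    then have "(1 + q * ?p * b) * (1 + b) * d \<le> (1 + q * ?p * b) * c"
      using 1 mult_right_mono[OF 2, of d] by linarith
    then show ?thesis using pos by (simp add: mult.assoc)
  qed
qed

section \<open>First-order inequality for convex functions\<close>

text \<open>Restriction to the line through \<open>y\<close> and \<open>x\<close> leaves the
  one-dimensional tangent inequality at \<open>0\<close>, evaluated at \<open>1\<close>.\<close>

lemma convex_on_above_gradient:
  fixes f :: "real^'n \<Rightarrow> real"
  assumes "convex_on UNIV f" "f differentiable (at y)"
  shows "f y + grad f y \<bullet> (x - y) \<le> f x"
proof -
  define \<phi> where "\<phi> s = f (y + s *\<^sub>R (x - y))" for s :: real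
  have "convex_on UNIV \<phi>"
  proof (rule convex_onI)
    fix t a b :: real assume t: "0 < t" "t < 1"
    have "y + ((1 - t) *\<^sub>R a + t *\<^sub>R b) *\<^sub>R (x - y)
        = (1 - t) *\<^sub>R (y + a *\<^sub>R (x - y)) + t *\<^sub>R (y + b *\<^sub>R (x - y))"
      by (simp add: algebra_simps)
    then show "\<phi> ((1 - t) *\<^sub>R a + t *\<^sub>R b) \<le> (1 - t) * \<phi> a + t * \<phi> b"
      unfolding \<phi>_def using convex_onD[OF assms(1), of t] t by simp
  qed simp
  moreover have "(\<phi> has_real_derivative grad f y \<bullet> (x - y)) (at 0)"
  proof -
    have f': "(f has_derivative (\<lambda>h. h \<bullet> grad f y)) (at (y + 0 *\<^sub>R (x - y)))"
      using GDERIV_grad[OF assms(2)] by (simp add: gderiv_def)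
    have "((\<lambda>s. y + s *\<^sub>R (x - y)) has_derivative (\<lambda>s. s *\<^sub>R (x - y))) (at (0::real))"
      by (auto intro!: derivative_eq_intros)
    from has_derivative_compose[OF this f']
    have "(\<phi> has_derivative (\<lambda>s. s * (grad f y \<bullet> (x - y)))) (at 0)"
      unfolding \<phi>_def by (simp add: inner_commute)
    moreover have "(\<lambda>s. s * (grad f y \<bullet> (x - y))) = (*) (grad f y \<bullet> (x - y))"
      by (simp add: fun_eq_iff mult.commute)
    ultimately show ?thesis
      by (simp add: has_field_derivative_def)
  qed
  ultimately have "\<phi> 1 - \<phi> 0 \<ge> (grad f y \<bullet> (x - y)) * (1 - 0)"
    by (intro convex_on_imp_above_tangent[where A=UNIV]) auto
  then show ?thesis by (simp add: \<phi>_def)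
qed

section \<open>The composite objective as a real function on its domain\<close>

locale composite_problem =
  fixes f :: "real^'n \<Rightarrow> real" and \<psi> :: "real^'n \<Rightarrow> ereal" and L :: "real^'n"
  assumes f_convex: "convex_on UNIV f"
    and f_diff: "f differentiable_on UNIV"
    and psi_proper: "proper_fun \<psi>"
    and psi_convex: "convex_fun \<psi>"
    and f_smooth: "smooth_wrt f L"
begin

abbreviation "D \<equiv> edom \<psi>"

text \<open>\<open>r\<close> and \<open>\<Phi>\<close> are the real-valued versions of \<open>\<psi>\<close> and \<open>F\<close>, meaningful on \<open>D\<close> only.\<close>

definition r :: "real^'n \<Rightarrow> real" where "r x = real_of_ereal (\<psi> x)"

definition \<Phi> :: "real^'n \<Rightarrow> real" where "\<Phi> x = f x + r x"

abbreviation "M \<equiv> minimizers (objective f \<psi>)"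

abbreviation Q :: "real^'n \<Rightarrow> real" where "Q x \<equiv> (wnorm L x)\<^sup>2"

lemma L_pos: "L $ i > 0"
  using f_smooth by (simp add: smooth_wrt_def)

lemma Q_minus_commute: "Q (a - b) = Q (b - a)"
  using wnorm_sq_scaleR[OF L_pos, of "-1" "a - b"] by simp

lemma psi_eq: "x \<in> D \<Longrightarrow> \<psi> x = ereal (r x)"
  using psi_proper by (cases "\<psi> x") (auto simp: r_def edom_def proper_fun_def)

lemma psi_infinite: "x \<notin> D \<Longrightarrow> \<psi> x = \<infinity>"
  by (simp add: edom_def)

lemma objective_eq: "x \<in> D \<Longrightarrow> objective f \<psi> x = ereal (\<Phi> x)"
  by (simp add: objective_def psi_eq \<Phi>_def)

lemma edom_objective: "edom (objective f \<psi>) = D"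
  by (auto simp: edom_def objective_def)

lemma r_convex:
  assumes "x \<in> D" "u \<in> D" "0 \<le> s" "s \<le> 1"
  shows "(1 - s) *\<^sub>R x + s *\<^sub>R u \<in> D"
    and "r ((1 - s) *\<^sub>R x + s *\<^sub>R u) \<le> (1 - s) * r x + s * r u"
proof -
  have "(x, r x) \<in> epi \<psi>" "(u, r u) \<in> epi \<psi>"
    using assms by (auto simp: epi_def psi_eq)
  then have "(1 - s) *\<^sub>R (x, r x) + s *\<^sub>R (u, r u) \<in> epi \<psi>"
    using psi_convex assms unfolding convex_fun_def by (intro convexD) auto
  then have *: "\<psi> ((1 - s) *\<^sub>R x + s *\<^sub>R u) \<le> ereal ((1 - s) * r x + s * r u)"
    by (simp add: epi_def)
  then show "(1 - s) *\<^sub>R x + s *\<^sub>R u \<in> D"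
    by (auto simp: edom_def intro: le_less_trans)
  from * psi_eq[OF this] show "r ((1 - s) *\<^sub>R x + s *\<^sub>R u) \<le> (1 - s) * r x + s * r u"
    by simp
qed

lemma above_gradient: "f y + grad f y \<bullet> (x - y) \<le> f x"
  using f_diff by (intro convex_on_above_gradient f_convex) (auto simp: differentiable_on_def)

lemma below_quadratic: "f x \<le> f y + grad f y \<bullet> (x - y) + 1/2 * Q (x - y)"
  using f_smooth by (auto simp: smooth_wrt_def)

lemma \<Phi>_convex:
  assumes "x \<in> D" "u \<in> D" "0 \<le> s" "s \<le> 1"
  shows "\<Phi> ((1 - s) *\<^sub>R x + s *\<^sub>R u) \<le> (1 - s) * \<Phi> x + s * \<Phi> u"
  using r_convex(2)[OF assms] convex_onD[OF f_convex assms(3,4), of x u]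
  by (simp add: \<Phi>_def algebra_simps)

text \<open>Properness supplies a point of finite value, which forces every minimizer into
  \<open>D\<close>, where real values can be compared.\<close>

lemma minimizers_iff: "u \<in> M \<longleftrightarrow> u \<in> D \<and> (\<forall>v\<in>D. \<Phi> u \<le> \<Phi> v)"
proof -
  obtain w where w: "w \<in> D"
    using psi_proper by (auto simp: proper_fun_def)
  have M: "u \<in> M \<longleftrightarrow> (\<forall>v. objective f \<psi> u \<le> objective f \<psi> v)"
    by (auto simp: minimizers_def is_arg_min_def not_less)
  have inf: "objective f \<psi> v = \<infinity>" if "v \<notin> D" for v
    using psi_infinite[OF that] by (simp add: objective_def)
  show ?thesis
  proof
    assume u: "u \<in> M"
    have "u \<in> D"
    proof (rule ccontr)
      assume "u \<notin> D"
      with u w inf objective_eq show False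
        unfolding M by (metis ereal_infty_less_eq(1) PInfty_neq_ereal(1))
    qed
    with u objective_eq show "u \<in> D \<and> (\<forall>v\<in>D. \<Phi> u \<le> \<Phi> v)"
      unfolding M by (metis ereal_less_eq(3))
  next
    assume "u \<in> D \<and> (\<forall>v\<in>D. \<Phi> u \<le> \<Phi> v)"
    then show "u \<in> M"
      unfolding M using objective_eq inf by (metis ereal_less_eq(1,3))
  qed
qed

lemma convex_minimizers: "convex M"
proof (rule convexI)
  fix x y and a b :: real
  assume xy: "x \<in> M" "y \<in> M" and ab: "0 \<le> a" "0 \<le> b" "a + b = 1"
  then have D: "x \<in> D" "y \<in> D" and a: "a = 1 - b" and b: "b \<le> 1"
    by (auto simp: minimizers_iff)
  show "a *\<^sub>R x + b *\<^sub>R y \<in> M"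
    unfolding minimizers_iff a
  proof (intro conjI ballI)
    show "(1 - b) *\<^sub>R x + b *\<^sub>R y \<in> D"
      by (rule r_convex[OF D ab(2) b])
    fix v assume "v \<in> D"
    then have "(1 - b) * \<Phi> x + b * \<Phi> y \<le> (1 - b) * \<Phi> v + b * \<Phi> v"
      using xy ab b by (intro add_mono mult_left_mono) (auto simp: minimizers_iff)
    with \<Phi>_convex[OF D ab(2) b] show "\<Phi> ((1 - b) *\<^sub>R x + b *\<^sub>R y) \<le> \<Phi> v"
      by (simp add: algebra_simps)
  qed
qed

section \<open>The proximal subproblem\<close>

text \<open>Serves both methods: FISTA has \<open>w = y\<close>, \<open>c = 1\<close>, and APG has
  \<open>w = z\<^sub>k\<close>, \<open>c = \<theta>\<^sub>k\<close>. The term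
  \<open>c / 2 * Q (u - p)\<close> is the growth of a strongly convex function away from its
  minimizer.\<close>

lemma prox_three_point:
  assumes p: "is_arg_min (\<lambda>u. ereal (g \<bullet> (u - y) + c / 2 * Q (u - w)) + \<psi> u) (\<lambda>_. True) p"
    and c: "c \<ge> 0"
  shows "p \<in> D"
    and "u \<in> D \<Longrightarrow> g \<bullet> (p - y) + c / 2 * Q (p - w) + r p + c / 2 * Q (u - p)
      \<le> g \<bullet> (u - y) + c / 2 * Q (u - w) + r u"
proof -
  define q where "q u = g \<bullet> (u - y) + c / 2 * Q (u - w)" for u
  have min: "ereal (q p) + \<psi> p \<le> ereal (q u) + \<psi> u" for u
    using p by (auto simp: is_arg_min_def not_less q_def)
  obtain v where v: "v \<in> D"
    using psi_proper by (auto simp: proper_fun_def)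
  show p: "p \<in> D"
    using min[of v] psi_eq[OF v] by (cases "\<psi> p") (auto simp: edom_def)
  assume u: "u \<in> D"
  \<comment> \<open>Comparing \<open>p\<close> with the point at fraction \<open>s\<close> towards
    \<open>u\<close> and cancelling \<open>s\<close> leaves the growth term weakened by
    \<open>1 - s\<close>; letting \<open>s\<close> tend to \<open>0\<close> removes that
    factor.\<close>
  have *: "q p + r p + c / 2 * Q (u - p) * (1 - s) \<le> q u + r u" if s: "0 < s" "s \<le> 1" for s
  proof -
    let ?v = "(1 - s) *\<^sub>R p + s *\<^sub>R u"
    have D: "?v \<in> D" and rv: "r ?v \<le> (1 - s) * r p + s * r u"
      using r_convex[OF p u] s by auto
    have v: "?v - y = (1 - s) *\<^sub>R (p - y) + s *\<^sub>R (u - y)" for y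
      by (simp add: algebra_simps)
    have "q ?v = (1 - s) * q p + s * q u - c / 2 * (s * (1 - s)) * Q (u - p)"
      unfolding q_def v wnorm_sq_convex_combination[OF L_pos]
      using Q_minus_commute[of p u]
      by (simp add: inner_add_right algebra_simps add_divide_distrib diff_divide_distrib)
    moreover have "q p + r p \<le> q ?v + r ?v"
      using min[of ?v] p D by (simp add: psi_eq)
    ultimately have "s * (q p + r p + c / 2 * Q (u - p) * (1 - s)) \<le> s * (q u + r u)"
      using rv by (simp add: algebra_simps)
    then show ?thesis using s by simp
  qed
  have "((\<lambda>s. q p + r p + c / 2 * Q (u - p) * (1 - s)) \<longlongrightarrow>
      q p + r p + c / 2 * Q (u - p) * (1 - 0)) (at_right 0)"
    by (intro tendsto_intros)
  moreover have "\<forall>\<^sub>F s in at_right (0::real). q p + r p + c / 2 * Q (u - p) * (1 - s) \<le> q u + r u"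
    using eventually_at_right_real[OF zero_less_one] by eventually_elim (rule *, auto)
  ultimately have "q p + r p + c / 2 * Q (u - p) * (1 - 0) \<le> q u + r u"
    by (intro tendsto_upperbound) auto
  then show "g \<bullet> (p - y) + c / 2 * Q (p - w) + r p + c / 2 * Q (u - p)
      \<le> g \<bullet> (u - y) + c / 2 * Q (u - w) + r u"
    by (simp add: q_def)
qed

section \<open>Accelerated steps\<close>

text \<open>The common interface of the two methods, free of \<open>y\<close> and of the subproblem;
  \<open>t\<close> stands for \<open>\<theta>\<^sub>k\<close>.\<close>

definition accel_step :: "real \<Rightarrow> real^'n \<Rightarrow> real^'n \<Rightarrow> real^'n \<Rightarrow> real^'n \<Rightarrow> bool" where
  "accel_step t x z x' z' \<longleftrightarrow> x' \<in> D \<and> x' = (1 - t) *\<^sub>R x + t *\<^sub>R z' \<and>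
     (\<forall>u\<in>D. \<Phi> x' \<le> (1 - t) * \<Phi> x + t * \<Phi> u + t\<^sup>2 / 2 * (Q (z - u) - Q (z' - u)))"

lemma accel_step_dom: "accel_step t x z x' z' \<Longrightarrow> x' \<in> D"
  unfolding accel_step_def by blast

text \<open>The linear model at \<open>y\<close> is affine, so it splits over the combination, and
  each part lies below \<open>f\<close>.\<close>

lemma linearization_combination:
  assumes "0 \<le> t" "t \<le> 1"
  shows "f y + grad f y \<bullet> ((1 - t) *\<^sub>R x + t *\<^sub>R u - y) \<le> (1 - t) * f x + t * f u"
proof -
  have "(1 - t) *\<^sub>R x + t *\<^sub>R u - y = (1 - t) *\<^sub>R (x - y) + t *\<^sub>R (u - y)"
    by (simp add: algebra_simps)
  then have "f y + grad f y \<bullet> ((1 - t) *\<^sub>R x + t *\<^sub>R u - y)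
      = (1 - t) * (f y + grad f y \<bullet> (x - y)) + t * (f y + grad f y \<bullet> (u - y))"
    by (simp add: inner_add_right algebra_simps)
  also have "\<dots> \<le> (1 - t) * f x + t * f u"
    using assms by (intro add_mono mult_left_mono above_gradient) auto
  finally show ?thesis .
qed

text \<open>The three-point inequality is applied at a mixture of \<open>x\<close> and
  \<open>u\<close>, whose displacements from \<open>y\<close> and \<open>x'\<close> are
  \<open>t\<close> times \<open>u - z\<close> and \<open>u - z'\<close>.\<close>

lemma fista_accel_step:
  assumes t: "0 < t" "t \<le> 1" and x: "x \<in> D"
    and y: "y = (1 - t) *\<^sub>R x + t *\<^sub>R z"
    and x': "is_arg_min (\<lambda>u. ereal (grad f y \<bullet> (u - y) + 1/2 * Q (u - y)) + \<psi> u) (\<lambda>_. True) x'"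
    and z': "z' = z + (1 / t) *\<^sub>R (x' - y)"
  shows "accel_step t x z x' z'"
proof -
  have eq: "x' = (1 - t) *\<^sub>R x + t *\<^sub>R z'"
    using t by (simp add: z' y algebra_simps)
  have D': "x' \<in> D"
    by (rule prox_three_point(1)[OF x']) simp
  have "\<Phi> x' \<le> (1 - t) * \<Phi> x + t * \<Phi> u + t\<^sup>2 / 2 * (Q (z - u) - Q (z' - u))"
    if u: "u \<in> D" for u
  proof -
    let ?v = "(1 - t) *\<^sub>R x + t *\<^sub>R u"
    have v: "?v \<in> D" "r ?v \<le> (1 - t) * r x + t * r u"
      using r_convex[OF x u] t by auto
    have "?v - y = t *\<^sub>R (u - z)" "?v - x' = t *\<^sub>R (u - z')"
      by (simp_all add: y eq algebra_simps)
    then have Q: "Q (?v - y) = t\<^sup>2 * Q (z - u)" "Q (?v - x') = t\<^sup>2 * Q (z' - u)"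
      by (simp_all add: wnorm_sq_scaleR[OF L_pos] Q_minus_commute[of u])
    have "\<Phi> x' \<le> f y + (grad f y \<bullet> (x' - y) + 1/2 * Q (x' - y) + r x')"
      using below_quadratic[of x' y] by (simp add: \<Phi>_def)
    also have "\<dots> \<le> f y + (grad f y \<bullet> (?v - y) + 1/2 * Q (?v - y) + r ?v - 1/2 * Q (?v - x'))"
      using prox_three_point(2)[OF x' _ v(1)] by simp
    also have "\<dots> \<le> (1 - t) * \<Phi> x + t * \<Phi> u + t\<^sup>2 / 2 * (Q (z - u) - Q (z' - u))"
      using linearization_combination[of t y x u] v(2) t unfolding Q \<Phi>_def
      by (simp add: algebra_simps)
    finally show ?thesis .
  qed
  with D' eq show ?thesis by (auto simp: accel_step_def)
qed

text \<open>The three-point inequality is applied at \<open>u\<close> itself and scaled by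
  \<open>t\<close>. Since \<open>x' - y\<close> is \<open>t\<close> times \<open>z' - z\<close>, the
  quadratic term of the smoothness bound cancels.\<close>

lemma apg_accel_step:
  assumes t: "0 < t" "t \<le> 1" and x: "x \<in> D"
    and y: "y = (1 - t) *\<^sub>R x + t *\<^sub>R z"
    and z': "is_arg_min (\<lambda>u. ereal (grad f y \<bullet> (u - y) + t / 2 * Q (u - z)) + \<psi> u) (\<lambda>_. True) z'"
    and x': "x' = y + t *\<^sub>R (z' - z)"
  shows "accel_step t x z x' z'"
proof -
  have eq: "x' = (1 - t) *\<^sub>R x + t *\<^sub>R z'"
    by (simp add: x' y algebra_simps)
  have Dz: "z' \<in> D"
    using t by (intro prox_three_point(1)[OF z']) simp
  have D': "x' \<in> D" and rx: "r x' \<le> (1 - t) * r x + t * r z'"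
    using r_convex[OF x Dz] t unfolding eq by auto
  have "\<Phi> x' \<le> (1 - t) * \<Phi> x + t * \<Phi> u + t\<^sup>2 / 2 * (Q (z - u) - Q (z' - u))"
    if u: "u \<in> D" for u
  proof -
    have "x' - y = t *\<^sub>R (z' - z)"
      by (simp add: x')
    then have Q: "Q (x' - y) = t\<^sup>2 * Q (z' - z)"
      by (simp add: wnorm_sq_scaleR[OF L_pos])
    have g: "grad f y \<bullet> (x' - y) = grad f y \<bullet> ((1 - t) *\<^sub>R x + t *\<^sub>R u - y)
        + t * (grad f y \<bullet> (z' - y)) - t * (grad f y \<bullet> (u - y))"
      by (simp add: eq inner_add_right inner_diff_right algebra_simps)
    have "t * (grad f y \<bullet> (z' - y) + t / 2 * Q (z' - z) + r z' + t / 2 * Q (u - z'))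
        \<le> t * (grad f y \<bullet> (u - y) + t / 2 * Q (u - z) + r u)"
      using prox_three_point(2)[OF z' _ u] t by (intro mult_left_mono) auto
    then have "t * (grad f y \<bullet> (z' - y)) - t * (grad f y \<bullet> (u - y)) + t\<^sup>2 / 2 * Q (z' - z) + t * r z'
        \<le> t * r u + t\<^sup>2 / 2 * (Q (z - u) - Q (z' - u))"
      unfolding Q_minus_commute[of u]
      by (simp add: algebra_simps power2_eq_square diff_divide_distrib)
    with below_quadratic[of x' y] rx linearization_combination[of t y x u] t
    show ?thesis unfolding Q g \<Phi>_def by (simp add: algebra_simps)
  qed
  with D' eq show ?thesis by (auto simp: accel_step_def)
qed

section \<open>Runs of accelerated steps\<close>

definition accel_output :: "real^'n \<Rightarrow> nat \<Rightarrow> real^'n \<Rightarrow> bool" where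
  "accel_output s K w \<longleftrightarrow> (\<exists>x z. x 0 = s \<and> z 0 = s \<and>
     (\<forall>k<K. accel_step (\<theta> k) (x k) (z k) (x (Suc k)) (z (Suc k))) \<and> w = x K)"

text \<open>The step lemmas ask for \<open>x k \<in> D\<close>, which the preceding step delivers;
  the induction is done here once for both methods.\<close>

lemma accel_outputI:
  assumes "s \<in> D" "x 0 = s" "z 0 = s" "w = x K"
    and step: "\<And>k. k < K \<Longrightarrow> x k \<in> D \<Longrightarrow> accel_step (\<theta> k) (x k) (z k) (x (Suc k)) (z (Suc k))"
  shows "accel_output s K w"
proof -
  have "k \<le> K \<Longrightarrow> x k \<in> D" for k
  proof (induction k)
    case (Suc k)
    then show ?case using accel_step_dom[OF step[of k]] by simp
  qed (simp add: assms)
  with assms show ?thesis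
    unfolding accel_output_def by (intro exI[of _ x] exI[of _ z]) auto
qed

lemma fista_accel_output:
  assumes "fista_output f \<psi> L s K w" "s \<in> D"
  shows "accel_output s K w"
proof -
  from assms(1) obtain x y z where *: "x 0 = s" "z 0 = s" "w = x K"
    "\<forall>k<K. y k = (1 - \<theta> k) *\<^sub>R x k + \<theta> k *\<^sub>R z k \<and>
      is_arg_min (\<lambda>u. ereal (grad f (y k) \<bullet> (u - y k) + 1/2 * Q (u - y k)) + \<psi> u)
        (\<lambda>_. True) (x (Suc k)) \<and>
      z (Suc k) = z k + (1 / \<theta> k) *\<^sub>R (x (Suc k) - y k)"
    unfolding fista_output_def by blast
  from assms(2) *(1-3) show ?thesis
  proof (rule accel_outputI)
    fix k assume "k < K" "x k \<in> D"
    with *(4) show "accel_step (\<theta> k) (x k) (z k) (x (Suc k)) (z (Suc k))"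
      by (intro fista_accel_step[of _ _ "y k"] theta_pos theta_le_1) blast+
  qed
qed

lemma apg_accel_output:
  assumes "apg_output f \<psi> L s K w" "s \<in> D"
  shows "accel_output s K w"
proof -
  from assms(1) obtain x y z where *: "x 0 = s" "z 0 = s" "w = x K"
    "\<forall>k<K. y k = (1 - \<theta> k) *\<^sub>R x k + \<theta> k *\<^sub>R z k \<and>
      is_arg_min (\<lambda>u. ereal (grad f (y k) \<bullet> (u - y k) + \<theta> k / 2 * Q (u - z k)) + \<psi> u)
        (\<lambda>_. True) (z (Suc k)) \<and>
      x (Suc k) = y k + \<theta> k *\<^sub>R (z (Suc k) - z k)"
    unfolding apg_output_def by blast
  from assms(2) *(1-3) show ?thesis
  proof (rule accel_outputI)
    fix k assume "k < K" "x k \<in> D"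
    with *(4) show "accel_step (\<theta> k) (x k) (z k) (x (Suc k)) (z (Suc k))"
      by (intro apg_accel_step[of _ _ "y k"] theta_pos theta_le_1) blast+
  qed
qed

text \<open>Division by \<open>(\<theta> k)\<^sup>2\<close> makes consecutive weights match through
  \<open>theta_Suc_sq\<close>, so the left-hand side does not increase with
  \<open>k\<close>.\<close>

lemma accel_telescope:
  assumes "x 0 = s" "z 0 = s"
    and step: "\<And>k. k < K \<Longrightarrow> accel_step (\<theta> k) (x k) (z k) (x (Suc k)) (z (Suc k))"
    and u: "u \<in> D"
  shows "k < K \<Longrightarrow> (\<Phi> (x (Suc k)) - \<Phi> u) / (\<theta> k)\<^sup>2 + 1/2 * Q (z (Suc k) - u) \<le> 1/2 * Q (s - u)"
proof (induction k)
  case 0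
  then have "\<Phi> (x (Suc 0)) \<le> \<Phi> u + 1/2 * (Q (s - u) - Q (z (Suc 0) - u))"
    using step[of 0] u assms(1,2) unfolding accel_step_def by (auto dest: bspec)
  then show ?case by (simp add: algebra_simps)
next
  case (Suc k)
  let ?t = "\<theta> (Suc k)"
  define e where "e k = (\<Phi> (x (Suc k)) - \<Phi> u) / (\<theta> k)\<^sup>2" for k
  have "\<Phi> (x (Suc (Suc k))) - \<Phi> u \<le> (1 - ?t) * (\<Phi> (x (Suc k)) - \<Phi> u)
      + ?t\<^sup>2 / 2 * (Q (z (Suc k) - u) - Q (z (Suc (Suc k)) - u))"
    using step[OF Suc.prems] u by (auto simp: accel_step_def algebra_simps)
  then have "(\<Phi> (x (Suc (Suc k))) - \<Phi> u) / ?t\<^sup>2 \<le> ((1 - ?t) * (\<Phi> (x (Suc k)) - \<Phi> u)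
      + ?t\<^sup>2 / 2 * (Q (z (Suc k) - u) - Q (z (Suc (Suc k)) - u))) / ?t\<^sup>2"
    by (rule divide_right_mono) simp
  also have "\<dots> = (1 - ?t) * (\<Phi> (x (Suc k)) - \<Phi> u) / ?t\<^sup>2
      + 1/2 * (Q (z (Suc k) - u) - Q (z (Suc (Suc k)) - u))"
    using theta_pos[of "Suc k"] by (simp add: add_divide_distrib)
  also have "(1 - ?t) * (\<Phi> (x (Suc k)) - \<Phi> u) / ?t\<^sup>2 = (\<Phi> (x (Suc k)) - \<Phi> u) / (\<theta> k)\<^sup>2"
    using theta_Suc_bounds(2)[OF theta_pos, of k] unfolding theta_Suc_sq by simp
  finally have "e (Suc k) \<le> e k + 1/2 * (Q (z (Suc k) - u) - Q (z (Suc (Suc k)) - u))"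
    by (simp only: e_def)
  then show ?case
    using Suc.IH[OF Suc_lessD[OF Suc.prems]] unfolding e_def[symmetric]
    by (simp add: right_diff_distrib)
qed

lemma accel_output_mono:
  assumes "accel_output s K w" "s \<in> D"
  shows "w \<in> D" "\<Phi> w \<le> \<Phi> s"
proof -
  from assms obtain x z where *: "x 0 = s" "z 0 = s" "w = x K"
    and step: "\<And>k. k < K \<Longrightarrow> accel_step (\<theta> k) (x k) (z k) (x (Suc k)) (z (Suc k))"
    unfolding accel_output_def by blast
  have "w \<in> D \<and> \<Phi> w \<le> \<Phi> s"
  proof (cases K)
    case (Suc k)
    have "(\<Phi> w - \<Phi> s) / (\<theta> k)\<^sup>2 + 1/2 * Q (z (Suc k) - s) \<le> 1/2 * Q (s - s)"
      using accel_telescope[OF *(1,2) step assms(2), of K k] by (simp add: *(3) Suc)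
    moreover have "Q (s - s) = 0"
      using wnorm_sq_scaleR[OF L_pos, of 0 s] by simp
    ultimately have "(\<Phi> w - \<Phi> s) / (\<theta> k)\<^sup>2 \<le> - (1/2 * Q (z (Suc k) - s))"
      by (simp only: diff_0[symmetric] le_diff_eq mult_zero_right)
    also have "\<dots> \<le> 0"
      by simp
    finally have "(\<Phi> w - \<Phi> s) / (\<theta> k)\<^sup>2 \<le> 0" .
    then have "\<Phi> w \<le> \<Phi> s"
      using theta_pos[of k] by (simp add: divide_le_0_iff)
    then show ?thesis using accel_step_dom[OF step[of k]] by (simp add: *(3) Suc)
  qed (use * assms in simp)
  then show "w \<in> D" "\<Phi> w \<le> \<Phi> s" by auto
qed

text \<open>An initial segment is itself a run, so the level bound of
  \<open>accel_output_mono\<close> reaches every inner iterate.\<close>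

lemma accel_prefix:
  assumes "x 0 = s" "z 0 = s" "j \<le> K"
    and "\<And>k. k < K \<Longrightarrow> accel_step (\<theta> k) (x k) (z k) (x (Suc k)) (z (Suc k))"
  shows "accel_output s j (x j)"
  unfolding accel_output_def using assms by (intro exI[of _ x] exI[of _ z]) auto

section \<open>Contraction over one run\<close>

text \<open>The constant \<open>m\<close> is kept separate from \<open>s\<close>, so that the one
  belonging to \<open>x0\<close> can serve at every restart.\<close>

lemma accel_contraction:
  assumes out: "accel_output s K w" and s: "s \<in> D" and K: "K \<ge> 1" and m: "m > 0" and M: "M \<noteq> {}"
    and growth: "\<And>v u. v \<in> D \<Longrightarrow> \<Phi> v \<le> \<Phi> s \<Longrightarrow> u \<in> M \<Longrightarrow> \<Phi> u + m / 2 * (wdist L v M)\<^sup>2 \<le> \<Phi> v"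
  shows "(wdist L w M)\<^sup>2 \<le> min ((\<theta> (K - 1))\<^sup>2 / m) (1 / (1 + m / (2 * (\<theta> (K - 1))\<^sup>2)))
    * (wdist L s M)\<^sup>2"
proof -
  define d where "d v = (wdist L v M)\<^sup>2" for v
  have d0: "d v \<ge> 0" for v by (simp add: d_def)
  from out obtain x z where *: "x 0 = s" "z 0 = s" "w = x K"
    and step: "\<And>k. k < K \<Longrightarrow> accel_step (\<theta> k) (x k) (z k) (x (Suc k)) (z (Suc k))"
    unfolding accel_output_def by blast
  \<comment> \<open>Every minimizer \<open>u\<close> gives the same lower bound on
    \<open>Q (s - u)\<close>; the infimum over \<open>u\<close> then yields
    \<open>d s\<close>.\<close>
  have energy: "m / (\<theta> k)\<^sup>2 * d (x (Suc k)) + d (z (Suc k)) \<le> d s" if k: "k < K" for k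
    unfolding d_def[of s] using M
  proof (rule wdist_sq_greatest[OF L_pos])
    fix u assume u: "u \<in> M"
    have "accel_output s (Suc k) (x (Suc k))"
      using k by (intro accel_prefix[OF *(1,2) _ step]) auto
    note x = accel_output_mono[OF this s]
    have "1/2 * (m / (\<theta> k)\<^sup>2 * d (x (Suc k))) = m / 2 * d (x (Suc k)) / (\<theta> k)\<^sup>2"
      by simp
    also have "\<dots> \<le> (\<Phi> (x (Suc k)) - \<Phi> u) / (\<theta> k)\<^sup>2"
      using growth[OF x u] by (intro divide_right_mono) (auto simp: d_def)
    finally have "1/2 * (m / (\<theta> k)\<^sup>2 * d (x (Suc k))) \<le> (\<Phi> (x (Suc k)) - \<Phi> u) / (\<theta> k)\<^sup>2" .
    moreover have "d (z (Suc k)) \<le> Q (z (Suc k) - u)"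
      unfolding d_def by (rule wdist_sq_le[OF L_pos u])
    moreover have "(\<Phi> (x (Suc k)) - \<Phi> u) / (\<theta> k)\<^sup>2 + 1/2 * Q (z (Suc k) - u) \<le> 1/2 * Q (s - u)"
      using u by (intro accel_telescope[OF *(1,2) step _ k]) (auto simp: minimizers_iff)
    moreover have "a + b \<le> c" if "1/2 * a \<le> e" "b \<le> q" "e + 1/2 * q \<le> 1/2 * c"
      for a b c e q :: real
      using that by linarith
    ultimately show "m / (\<theta> k)\<^sup>2 * d (x (Suc k)) + d (z (Suc k)) \<le> Q (s - u)"
      by blast
  qed
  have rate: "(1 + m / (2 * (\<theta> k)\<^sup>2)) * d (x (Suc k)) \<le> d s" if "k < K" for k
    using that
  proof (induction k)
    case 0
    \<comment> \<open>As \<open>\<theta> 0 = 1\<close>, the energy bound alone gives the factor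
      \<open>1 + m\<close>, more than the required \<open>1 + m / 2\<close>.\<close>
    have "x (Suc 0) = z (Suc 0)"
      using step[OF 0] by (simp add: accel_step_def)
    then have "m * d (x (Suc 0)) + d (x (Suc 0)) \<le> d s"
      using energy[OF 0] by simp
    moreover have "0 \<le> m * d (x (Suc 0))"
      using m d0 by simp
    ultimately show ?case by (simp add: algebra_simps)
  next
    case (Suc k)
    let ?q = "\<theta> (Suc k)"
    have q: "0 < ?q" "?q < 1"
      using theta_Suc_bounds[OF theta_pos] by auto
    show ?case
    proof (rule contraction_step[OF q])
      show "0 \<le> m / (2 * ?q\<^sup>2)" using m by simp
      show "0 \<le> d s" by (rule d0)
      have "(1 - ?q) * (m / (2 * ?q\<^sup>2)) = m / (2 * (\<theta> k)\<^sup>2)"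
        using q unfolding theta_Suc_sq by simp
      then show "(1 + (1 - ?q) * (m / (2 * ?q\<^sup>2))) * d (x (Suc k)) \<le> d s"
        using Suc by simp
      have "x (Suc (Suc k)) = (1 - ?q) *\<^sub>R x (Suc k) + ?q *\<^sub>R z (Suc (Suc k))"
        using step[OF Suc.prems] by (simp add: accel_step_def)
      then have "d (x (Suc (Suc k))) \<le> (1 - ?q) * d (x (Suc k)) + ?q * d (z (Suc (Suc k)))"
        unfolding d_def using wdist_sq_convex[OF L_pos convex_minimizers M q] by simp
      also have "\<dots> \<le> (1 - ?q) * d (x (Suc k)) + ?q * (d s - m / ?q\<^sup>2 * d (x (Suc (Suc k))))"
        using energy[OF Suc.prems] q by (intro add_left_mono mult_left_mono) auto
      \<comment> \<open>With \<open>b = m / (2 * ?q\<^sup>2)\<close>, the energy coefficient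
        \<open>m / ?q\<^sup>2\<close> is the \<open>2 * b\<close> of
        \<open>contraction_step\<close>.\<close>
      finally show "d (x (Suc (Suc k))) \<le> (1 - ?q) * d (x (Suc k))
          + ?q * (d s - 2 * (m / (2 * ?q\<^sup>2)) * d (x (Suc (Suc k))))"
        by simp
    qed
  qed
  let ?t = "\<theta> (K - 1)"
  have t: "?t\<^sup>2 > 0" using theta_pos[of "K - 1"] by simp
  \<comment> \<open>As \<open>K \<ge> 1\<close>, the last step has index
    \<open>K - 1\<close>.\<close>
  have w: "w = x (Suc (K - 1))" and k: "K - 1 < K" using K * by auto
  have "m / ?t\<^sup>2 * d w \<le> m / ?t\<^sup>2 * d w + d (z (Suc (K - 1)))"
    using d0 by simp
  also have "\<dots> \<le> d s"
    using energy[OF k] unfolding w .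
  finally have "m / ?t\<^sup>2 * d w \<le> d s" .
  then have 1: "d w \<le> ?t\<^sup>2 / m * d s"
    using t m by (simp add: field_simps)
  have "(1 + m / (2 * ?t\<^sup>2)) * d w \<le> d s"
    using rate[OF k] unfolding w .
  moreover have "0 < 1 + m / (2 * ?t\<^sup>2)"
    using t m by (intro add_pos_pos) auto
  ultimately have 2: "d w \<le> 1 / (1 + m / (2 * ?t\<^sup>2)) * d s"
    by (simp add: pos_le_divide_eq mult.commute)
  from 1 2 show ?thesis
    unfolding d_def by (simp add: min_def)
qed

section \<open>From the error bound to all restarts\<close>

text \<open>A minimizer \<open>u\<close> attains the infimum \<open>min_value\<close>, which turns
  the extended-real bound into one between values of \<open>\<Phi>\<close>.\<close>

lemma local_error_boundD:
  assumes leb: "local_error_bound (objective f \<psi>) L \<mu>" and s: "s \<in> D"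
  shows "\<mu> L s > 0"
    and "\<And>v u. v \<in> D \<Longrightarrow> \<Phi> v \<le> \<Phi> s \<Longrightarrow> u \<in> M \<Longrightarrow> \<Phi> u + \<mu> L s / 2 * (wdist L v M)\<^sup>2 \<le> \<Phi> v"
proof -
  show "\<mu> L s > 0"
    using leb s by (auto simp: local_error_bound_def edom_objective)
  fix v u assume v: "v \<in> D" "\<Phi> v \<le> \<Phi> s" and u: "u \<in> M"
  have "min_value (objective f \<psi>) = objective f \<psi> u"
    unfolding min_value_def using u
    by (intro antisym INF_lower INF_greatest) (auto simp: minimizers_def is_arg_min_def not_less)
  then have min: "min_value (objective f \<psi>) = ereal (\<Phi> u)"
    using u by (simp add: minimizers_iff objective_eq)
  have "objective f \<psi> v \<le> objective f \<psi> s"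
    using v s by (simp add: objective_eq)
  then have "min_value (objective f \<psi>) + ereal (\<mu> L s / 2 * (wdist L v M)\<^sup>2) \<le> objective f \<psi> v"
    using leb s by (auto simp: local_error_bound_def edom_objective)
  then show "\<Phi> u + \<mu> L s / 2 * (wdist L v M)\<^sup>2 \<le> \<Phi> v"
    using v by (simp add: min objective_eq)
qed

end

theorem corollary3:
  fixes f :: "real^'n \<Rightarrow> real" and \<psi> :: "real^'n \<Rightarrow> ereal"
    and L x0 :: "real^'n" and \<mu> :: "real^'n \<Rightarrow> real^'n \<Rightarrow> real"
    and K :: nat and x :: "nat \<Rightarrow> real^'n"
  assumes "convex_on UNIV f" and "f differentiable_on UNIV"
    and "proper_fun \<psi>" and "closed_fun \<psi>" and "convex_fun \<psi>"
    and "minimizers (objective f \<psi>) \<noteq> {}"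
    and "smooth_wrt f L"
    and "local_error_bound (objective f \<psi>) L \<mu>"
    and "x0 \<in> edom (objective f \<psi>)"
    and "K \<ge> 1"
    and "fixed_res f \<psi> L x0 K x"
  shows "\<forall>t. (wdist L (x (t * K)) (minimizers (objective f \<psi>)))\<^sup>2
     \<le> (min ((\<theta> (K - 1))\<^sup>2 / \<mu> L x0) (1 / (1 + \<mu> L x0 / (2 * (\<theta> (K - 1))\<^sup>2)))) ^ t
        * (wdist L x0 (minimizers (objective f \<psi>)))\<^sup>2"
proof -
  interpret composite_problem f \<psi> L
    by standard (fact assms)+
  have x0: "x0 \<in> D"
    using assms(9) by (simp add: edom_objective)
  note mu = local_error_boundD[OF assms(8) x0]
  let ?\<rho> = "min ((\<theta> (K - 1))\<^sup>2 / \<mu> L x0) (1 / (1 + \<mu> L x0 / (2 * (\<theta> (K - 1))\<^sup>2)))"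
  have rho: "0 \<le> ?\<rho>"
    using mu(1) by simp
  have start: "x 0 = x0"
    using assms(11) by (simp add: fixed_res_def)
  have out: "accel_output (x (t * K)) K (x (Suc t * K))" if "x (t * K) \<in> D" for t
    using assms(11) that fista_accel_output apg_accel_output
    unfolding fixed_res_def by (metis Suc_eq_plus1)
  have level: "x (t * K) \<in> D \<and> \<Phi> (x (t * K)) \<le> \<Phi> x0" for t
  proof (induction t)
    case (Suc t)
    with accel_output_mono[OF out, of t] show ?case by auto
  qed (simp add: start x0)
  have "(wdist L (x (t * K)) M)\<^sup>2 \<le> ?\<rho> ^ t * (wdist L x0 M)\<^sup>2" for t
  proof (induction t)
    case (Suc t)
    have D: "x (t * K) \<in> D" and le: "\<Phi> (x (t * K)) \<le> \<Phi> x0"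
      using level[of t] by auto
    have "(wdist L (x (Suc t * K)) M)\<^sup>2 \<le> ?\<rho> * (wdist L (x (t * K)) M)\<^sup>2"
      \<comment> \<open>The level set of the restart point lies inside that of \<open>x0\<close>, so
        the growth bound with \<open>\<mu> L x0\<close> covers this run.\<close>
      using le by (intro accel_contraction[OF out[OF D] D assms(10) mu(1) assms(6)] mu(2)) auto
    also have "\<dots> \<le> ?\<rho> * (?\<rho> ^ t * (wdist L x0 M)\<^sup>2)"
      by (rule mult_left_mono[OF Suc rho])
    finally show ?case by (simp only: power_Suc mult.assoc)
  qed (simp add: start)
  then show ?thesis by blast
qed

end
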